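(* Let $\cos(\alpha) = 0$ and $\kappa = 0$. Then for any $g \in SU_2$ the infimum of the cost of admissible decompositions of $g$ is attained on an admissible word of length at most $3$.
   Context: Setting. $SU_2$ is realized as the group of unit quaternions, and its Lie algebra $su_2$ as the space of purely imaginary quaternions with orthonormal basis $i,j,k$. $X, Y \in su_2$ have norm $1$, and $\alpha \in (0,\pi)$ is the angle between them (e.g. $X = i$, $Y = i\cos\alpha + j\sin\alpha$). The set of controls is $S = \{X,Y\}$. The cost factor of $X$ is $1$ and the cost factor of $Y$ is $\kappa$, where $0 \le \kappa \le 1$. An admissible word of length $n \ge 0$ is an expression $\exp(t_1 C_1)\cdots\exp(t_n C_n)$ with $t_i \ge 0$, $C_i \in S$ (for $n=0$ it is the identity). Its cost is $\sum_i \kappa_i t_i$, with $\kappa_i = 1$ if $C_i = X$ and $\kappa_i = \kappa$ if $C_i = Y$. The infimum of the cost for $g$ is taken over all admissible words of all lengths equal to $g$. *)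

theory Defs
  imports "HOL-Analysis.Analysis"
begin

text \<open>The real quaternions \<open>a + b i + c j + d k\<close>, as a normed division algebra and a
  four-dimensional Euclidean space, so that the library's \<^term>\<open>exp\<close> applies to them.\<close>

datatype quat = Quat (qRe: real) (qI: real) (qJ: real) (qK: real)

lemma quat_eq_iff: "x = y \<longleftrightarrow> qRe x = qRe y \<and> qI x = qI y \<and> qJ x = qJ y \<and> qK x = qK y"
  by (cases x; cases y) simp

instantiation quat :: ab_group_add
begin

definition "0 = Quat 0 0 0 0"
definition "x + y = Quat (qRe x + qRe y) (qI x + qI y) (qJ x + qJ y) (qK x + qK y)"
definition "- x = Quat (- qRe x) (- qI x) (- qJ x) (- qK x)"
definition "x - y = Quat (qRe x - qRe y) (qI x - qI y) (qJ x - qJ y) (qK x - qK y)"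

instance
  by standard (auto simp: zero_quat_def plus_quat_def uminus_quat_def minus_quat_def)

end

lemma quat_add_sel [simp]:
  "qRe (x + y) = qRe x + qRe y" "qI (x + y) = qI x + qI y"
  "qJ (x + y) = qJ x + qJ y" "qK (x + y) = qK x + qK y"
  by (simp_all add: plus_quat_def)

lemma quat_diff_sel [simp]:
  "qRe (x - y) = qRe x - qRe y" "qI (x - y) = qI x - qI y"
  "qJ (x - y) = qJ x - qJ y" "qK (x - y) = qK x - qK y"
  by (simp_all add: minus_quat_def)

lemma quat_uminus_sel [simp]:
  "qRe (- x) = - qRe x" "qI (- x) = - qI x" "qJ (- x) = - qJ x" "qK (- x) = - qK x"
  by (simp_all add: uminus_quat_def)

lemma quat_zero_sel [simp]: "qRe 0 = 0" "qI 0 = 0" "qJ 0 = 0" "qK 0 = 0"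
  by (simp_all add: zero_quat_def)

instantiation quat :: real_vector
begin

definition "r *\<^sub>R x = Quat (r * qRe x) (r * qI x) (r * qJ x) (r * qK x)"

instance
  by standard (auto simp: scaleR_quat_def quat_eq_iff algebra_simps)

end

lemma quat_scaleR_sel [simp]:
  "qRe (r *\<^sub>R x) = r * qRe x" "qI (r *\<^sub>R x) = r * qI x"
  "qJ (r *\<^sub>R x) = r * qJ x" "qK (r *\<^sub>R x) = r * qK x"
  by (simp_all add: scaleR_quat_def)

instantiation quat :: real_algebra_1
begin

definition "1 = Quat 1 0 0 0"

definition "x * y = Quat
  (qRe x * qRe y - qI x * qI y - qJ x * qJ y - qK x * qK y)
  (qRe x * qI y + qI x * qRe y + qJ x * qK y - qK x * qJ y)
  (qRe x * qJ y - qI x * qK y + qJ x * qRe y + qK x * qI y)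
  (qRe x * qK y + qI x * qJ y - qJ x * qI y + qK x * qRe y)"

instance
  by standard (auto simp: one_quat_def times_quat_def quat_eq_iff algebra_simps)

end

lemma quat_one_sel [simp]: "qRe 1 = 1" "qI 1 = 0" "qJ 1 = 0" "qK 1 = 0"
  by (simp_all add: one_quat_def)

lemma quat_mult_sel [simp]:
  "qRe (x * y) = qRe x * qRe y - qI x * qI y - qJ x * qJ y - qK x * qK y"
  "qI (x * y) = qRe x * qI y + qI x * qRe y + qJ x * qK y - qK x * qJ y"
  "qJ (x * y) = qRe x * qJ y - qI x * qK y + qJ x * qRe y + qK x * qI y"
  "qK (x * y) = qRe x * qK y + qI x * qJ y - qJ x * qI y + qK x * qRe y"
  by (simp_all add: times_quat_def)

instantiation quat :: real_inner
begin

definition "inner x y = qRe x * qRe y + qI x * qI y + qJ x * qJ y + qK x * qK y"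
definition "norm (x::quat) = sqrt (inner x x)"
definition "sgn (x::quat) = x /\<^sub>R norm x"
definition "dist (x::quat) y = norm (x - y)"
definition uniformity_quat_def [code del]:
  "(uniformity :: (quat \<times> quat) filter) = (INF e\<in>{0 <..}. principal {(x, y). dist x y < e})"
definition open_quat_def [code del]:
  "open (U :: quat set) \<longleftrightarrow> (\<forall>x\<in>U. eventually (\<lambda>(x', y). x' = x \<longrightarrow> y \<in> U) uniformity)"

instance
proof
  fix x y z :: quat and r :: real
  show "dist x y = norm (x - y)" by (rule dist_quat_def)
  show "sgn x = x /\<^sub>R norm x" by (rule sgn_quat_def)
  show "(uniformity :: (quat \<times> quat) filter) = (INF e\<in>{0 <..}. principal {(x, y). dist x y < e})"
    by (rule uniformity_quat_def)
  show "open U \<longleftrightarrow> (\<forall>x\<in>U. eventually (\<lambda>(x', y). x' = x \<longrightarrow> y \<in> U) uniformity)" for U :: "quat set"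
    by (rule open_quat_def)
  show "inner x y = inner y x" by (simp add: inner_quat_def mult.commute)
  show "inner (x + y) z = inner x z + inner y z" by (simp add: inner_quat_def algebra_simps)
  show "inner (r *\<^sub>R x) y = r * inner x y" by (simp add: inner_quat_def algebra_simps)
  show "0 \<le> inner x x" by (simp add: inner_quat_def)
  have "inner x x = 0 \<longleftrightarrow> (qRe x)\<^sup>2 + (qI x)\<^sup>2 + (qJ x)\<^sup>2 + (qK x)\<^sup>2 = 0"
    by (simp add: inner_quat_def power2_eq_square)
  also have "\<dots> \<longleftrightarrow> x = 0"
    by (simp add: quat_eq_iff add_nonneg_eq_0_iff)
  finally show "inner x x = 0 \<longleftrightarrow> x = 0" .
  show "norm x = sqrt (inner x x)" by (rule norm_quat_def)
qed

end

lemma norm_mult_quat: "norm (x * y) = norm x * norm (y::quat)"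
proof -
  have "inner (x * y) (x * y) = inner x x * inner y y"
    by (simp add: inner_quat_def algebra_simps)
  then show ?thesis
    by (simp add: norm_quat_def real_sqrt_mult)
qed

instantiation quat :: real_normed_div_algebra
begin

text \<open>The inverse is the conjugate divided by the squared norm.\<close>

definition "inverse (x::quat) = Quat (qRe x) (- qI x) (- qJ x) (- qK x) /\<^sub>R inner x x"
definition "x div (y::quat) = x * inverse y"

instance
proof
  fix x y :: quat
  show "norm (x * y) = norm x * norm y" by (rule norm_mult_quat)
  show "x div y = x * inverse y" by (rule divide_quat_def)
  show "inverse (0::quat) = 0" by (simp add: inverse_quat_def)
  {
    assume "x \<noteq> 0"
    then have n: "inner x x \<noteq> 0" by simp
    have "Quat (qRe x) (- qI x) (- qJ x) (- qK x) * x = inner x x *\<^sub>R 1"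
      and "x * Quat (qRe x) (- qI x) (- qJ x) (- qK x) = inner x x *\<^sub>R 1"
      by (simp_all add: quat_eq_iff inner_quat_def)
    with n show "inverse x * x = 1" and "x * inverse x = 1"
      by (simp_all add: inverse_quat_def)
  }
qed

end

instantiation quat :: euclidean_space
begin

definition "Basis = {Quat 1 0 0 0, Quat 0 1 0 0, Quat 0 0 1 0, Quat 0 0 0 1}"

instance
proof
  show "(Basis :: quat set) \<noteq> {}" and "finite (Basis :: quat set)"
    by (simp_all add: Basis_quat_def)
  show "inner u v = (if u = v then 1 else 0)" if "u \<in> Basis" "v \<in> Basis" for u v :: quat
    using that unfolding Basis_quat_def by (elim insertE emptyE) (simp_all add: inner_quat_def)
  show "(\<forall>u\<in>Basis. inner x u = 0) \<longleftrightarrow> x = 0" for x :: quat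
    by (cases x) (simp add: Basis_quat_def inner_quat_def zero_quat_def)
qed

end

instance quat :: banach ..


definition SU2 :: "quat set" where
  "SU2 = {q. norm q = 1}"

definition su2 :: "quat set" where
  "su2 = {q. qRe q = 0}"

definition vec_angle :: "'a::real_inner \<Rightarrow> 'a \<Rightarrow> real" where
  "vec_angle u v = arccos (inner u v / (norm u * norm v))"

text \<open>A word \<open>exp (t\<^sub>1 C\<^sub>1) \<cdots> exp (t\<^sub>n C\<^sub>n)\<close> is represented by the list of the pairs \<open>(t\<^sub>i, C\<^sub>i)\<close>.\<close>

type_synonym word = "(real \<times> quat) list"

definition admissible :: "quat \<Rightarrow> quat \<Rightarrow> word \<Rightarrow> bool" where
  "admissible X Y w \<longleftrightarrow> (\<forall>(t, C)\<in>set w. 0 \<le> t \<and> C \<in> {X, Y})"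

definition word_value :: "word \<Rightarrow> quat" where
  "word_value w = prod_list (map (\<lambda>(t, C). exp (t *\<^sub>R C)) w)"

text \<open>The cost factor is \<open>1\<close> for \<open>X\<close> and \<open>\<kappa>\<close> for the other control \<open>Y\<close>; this is meaningful
  for admissible words with \<open>X \<noteq> Y\<close>.\<close>

definition word_cost :: "quat \<Rightarrow> real \<Rightarrow> word \<Rightarrow> real" where
  "word_cost X \<kappa> w = (\<Sum>(t, C)\<leftarrow>w. (if C = X then 1 else \<kappa>) * t)"

text \<open>For \<open>\<kappa> \<ge> 0\<close> the costs are bounded below by \<open>0\<close>, so \<^term>\<open>Inf\<close> is the genuine infimum
  as soon as some admissible word has value \<open>g\<close>.\<close>

definition inf_cost :: "quat \<Rightarrow> quat \<Rightarrow> real \<Rightarrow> quat \<Rightarrow> real" where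
  "inf_cost X Y \<kappa> g = Inf {word_cost X \<kappa> w | w. admissible X Y w \<and> word_value w = g}"

end

theory Submission
  imports Defs
begin

text \<open>The control \<open>Y\<close> makes the quaternions a left vector space over the copy \<open>\<real> + \<real> Y\<close> of \<open>\<complex>\<close>, with
  \<open>q = z + w\<close>, where \<open>z\<close> commutes and \<open>w\<close> anticommutes with \<open>Y\<close>. The free factors \<open>exp (t Y)\<close> preserve
  \<open>\<bar>z\<bar>\<close> and \<open>\<bar>w\<bar>\<close>, while \<open>exp (t X)\<close> changes the angle \<open>arccos \<bar>z\<bar>\<close> by at most \<open>t\<close>; hence every word
  for a unit quaternion \<open>g\<close> costs at least \<open>arccos \<bar>z\<bar>\<close>. The Euler angle decomposition
  \<open>g = exp (a Y) exp (b X) exp (c Y)\<close> with \<open>b = arccos \<bar>z\<bar>\<close> attains this bound.\<close>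

section \<open>Euler's formula for square roots of -1\<close>

definition complex_emb :: "'a::real_normed_div_algebra \<Rightarrow> complex \<Rightarrow> 'a" where
  "complex_emb Y z = of_real (Re z) + Im z *\<^sub>R Y"

lemma complex_emb_mult:
  assumes "Y * Y = -1"
  shows "complex_emb Y (u * v) = complex_emb Y u * complex_emb Y v"
  using assms by (simp add: complex_emb_def of_real_def algebra_simps)

lemma bounded_linear_complex_emb: "bounded_linear (complex_emb Y)"
  unfolding complex_emb_def
  by (intro bounded_linear_add bounded_linear_compose[OF bounded_linear_of_real bounded_linear_Re]
      bounded_linear_compose[OF bounded_linear_scaleR_left bounded_linear_Im])

text \<open>A square root \<open>Y\<close> of -1 makes \<open>complex_emb Y\<close> a continuous
  homomorphism of real algebras, so it may be applied to the exponential series term by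
  term.\<close>

lemma exp_complex_emb:
  fixes Y :: "'a::{real_normed_div_algebra,banach}"
  assumes "Y * Y = -1"
  shows "exp (complex_emb Y z) = complex_emb Y (exp z)"
proof -
  have pow: "complex_emb Y (z ^ n) = complex_emb Y z ^ n" for n
    by (induction n) (simp_all add: complex_emb_mult[OF assms], simp add: complex_emb_def)
  have "(\<lambda>n. complex_emb Y (z ^ n /\<^sub>R fact n)) sums complex_emb Y (exp z)"
    by (intro bounded_linear.sums[OF bounded_linear_complex_emb] exp_converges)
  then have "(\<lambda>n. complex_emb Y z ^ n /\<^sub>R fact n) sums complex_emb Y (exp z)"
    by (simp add: pow linear_cmul[OF bounded_linear.linear[OF bounded_linear_complex_emb]]
        del: scaleR_complex.simps)
  then show ?thesis
    by (rule sums_unique2[OF exp_converges])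
qed

lemma exp_scaleR_imaginary_unit:
  fixes Y :: "'a::{real_normed_div_algebra,banach}"
  assumes "Y * Y = -1"
  shows "exp (t *\<^sub>R Y) = of_real (cos t) + sin t *\<^sub>R Y"
  using exp_complex_emb[OF assms, of "\<i> * of_real t"]
  by (simp add: complex_emb_def flip: cis_conv_exp)

lemma norm_imaginary_unit:
  fixes Y :: "'a::real_normed_div_algebra"
  assumes "Y * Y = -1"
  shows "norm Y = 1"
proof -
  have "norm Y * norm Y = 1"
    using norm_mult[of Y Y] assms by simp
  then show ?thesis
    using square_eq_1_iff[of "norm Y"] norm_ge_zero[of Y] by force
qed

text \<open>The imaginary coordinates of \<open>Y * Y\<close> are twice \<open>qRe Y\<close> times
  those of \<open>Y\<close>, so a nonzero \<open>qRe Y\<close> would make \<open>Y\<close> real,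
  with nonnegative square. The geometric hypotheses on a control thereby become one algebraic
  identity.\<close>

lemma quat_imaginary_unit_iff: "Y * Y = -1 \<longleftrightarrow> Y \<in> su2 \<and> norm Y = 1"
proof
  assume Y: "Y * Y = -1"
  have "qRe Y = 0"
  proof (rule ccontr)
    assume "qRe Y \<noteq> 0"
    moreover have "qRe Y * qI Y = 0" "qRe Y * qJ Y = 0" "qRe Y * qK Y = 0"
      using Y by (auto simp: quat_eq_iff)
    ultimately have "qRe Y * qRe Y = -1"
      using Y by (simp add: quat_eq_iff)
    then show False
      using zero_le_square[of "qRe Y"] by linarith
  qed
  then show "Y \<in> su2 \<and> norm Y = 1"
    using norm_imaginary_unit[OF Y] by (simp add: su2_def)
next
  assume "Y \<in> su2 \<and> norm Y = 1"
  then show "Y * Y = -1"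
    by (auto simp: su2_def norm_quat_def inner_quat_def quat_eq_iff)
qed

lemma quat_anticommute:
  assumes "X \<in> su2" "Y \<in> su2" "inner X Y = 0"
  shows "Y * X = - (X * Y)"
  using assms by (simp add: su2_def inner_quat_def quat_eq_iff algebra_simps)

lemma norm_exp_imaginary_unit:
  fixes Y :: quat
  assumes "Y * Y = -1"
  shows "norm (exp (t *\<^sub>R Y)) = 1"
proof -
  have "inner 1 Y = 0" and "inner 1 (1::quat) = 1"
    using assms unfolding quat_imaginary_unit_iff by (simp_all add: su2_def inner_quat_def)
  then have "(norm (exp (t *\<^sub>R Y)))\<^sup>2 = 1"
    using norm_imaginary_unit[OF assms]
    by (simp add: exp_scaleR_imaginary_unit[OF assms] power2_norm_eq_inner of_real_def
        inner_add_left inner_add_right inner_commute[of Y 1] flip: mult.assoc power2_eq_square)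
      (simp add: norm_eq_1)
  then show ?thesis
    by (simp add: power2_eq_1_iff) (metis norm_ge_zero not_one_le_zero neg_0_le_iff_le)
qed

section \<open>Commuting and anticommuting parts of a quaternion\<close>

definition com_part :: "quat \<Rightarrow> quat \<Rightarrow> quat" where
  "com_part Y q = (1/2) *\<^sub>R (q - Y * q * Y)"

definition anticom_part :: "quat \<Rightarrow> quat \<Rightarrow> quat" where
  "anticom_part Y q = (1/2) *\<^sub>R (q + Y * q * Y)"

lemma com_part_add_anticom_part: "com_part Y q + anticom_part Y q = q"
  by (simp add: com_part_def anticom_part_def flip: scaleR_add_right scaleR_2)

text \<open>As \<open>inverse Y = - Y\<close>, the part is the average of \<open>q\<close> and its
  conjugate \<open>Y * q * inverse Y\<close>. Conjugation by \<open>Y\<close> is an involution,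
  because \<open>Y * Y\<close> is central, so it fixes this average.\<close>

lemma com_part_commute:
  assumes "Y * Y = -1"
  shows "Y * com_part Y q = com_part Y q * Y"
  using assms by (simp add: com_part_def algebra_simps mult.assoc[of _ Y Y])
    (simp flip: mult.assoc)

lemma anticom_part_anticommute:
  assumes "Y * Y = -1"
  shows "Y * anticom_part Y q = - (anticom_part Y q * Y)"
  using assms by (simp add: anticom_part_def algebra_simps mult.assoc[of _ Y Y])
    (simp flip: mult.assoc)

text \<open>This is the parallelogram law for \<open>q\<close> and \<open>Y * q * Y\<close>, which
  have the same norm.\<close>

lemma norm_com_part_anticom_part:
  assumes "Y * Y = -1"
  shows "(norm (com_part Y q))\<^sup>2 + (norm (anticom_part Y q))\<^sup>2 = (norm q)\<^sup>2"
proof -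
  have "norm (Y * q * Y) = norm q"
    by (simp add: norm_mult norm_imaginary_unit[OF assms])
  then show ?thesis
    by (simp add: com_part_def anticom_part_def power_divide power2_norm_eq_inner
        inner_diff_left inner_diff_right inner_add_left inner_add_right)
      (simp add: norm_eq_sqrt_inner field_simps)
qed

lemma norm_com_part_le:
  assumes "Y * Y = -1"
  shows "norm (com_part Y q) \<le> norm q"
  using norm_com_part_anticom_part[OF assms, of q] zero_le_power2[of "norm (anticom_part Y q)"]
  by (intro power2_le_imp_le[OF _ norm_ge_zero]) linarith

lemma com_part_mult_commuting:
  assumes "Y * u = u * Y"
  shows "com_part Y (u * q) = u * com_part Y q"
  using assms by (simp add: com_part_def algebra_simps flip: mult.assoc)

text \<open>Moving \<open>Y\<close> past \<open>u\<close> flips the sign of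
  \<open>Y * q * Y\<close>. Taken with \<open>u = X\<close>, this shows how the paid control mixes
  the two parts.\<close>

lemma com_part_mult_anticommuting:
  assumes "Y * u = - (u * Y)"
  shows "com_part Y (u * q) = u * anticom_part Y q"
  using assms by (simp add: com_part_def anticom_part_def algebra_simps flip: mult.assoc)

section \<open>Lower bound for the cost of a word\<close>

lemma norm_com_part_exp_same:
  assumes "Y * Y = -1"
  shows "norm (com_part Y (exp (t *\<^sub>R Y) * q)) = norm (com_part Y q)"
proof -
  have "Y * exp (t *\<^sub>R Y) = exp (t *\<^sub>R Y) * Y"
    by (simp add: exp_scaleR_imaginary_unit[OF assms] of_real_def algebra_simps)
  then show ?thesis
    by (simp add: com_part_mult_commuting norm_mult norm_exp_imaginary_unit[OF assms])
qed

text \<open>For \<open>q\<close> with parts z and w, the commuting part of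
  \<open>exp (t *\<^sub>R X) * q\<close> is cos t z + sin t X w. Its norm is at least cos t |z| -
  sin t |w|, where |z| \<ge> cos T and hence |w| \<le> sin T; the addition formula for the cosine
  finishes.\<close>

lemma norm_com_part_exp_orthogonal:
  assumes "X * X = -1" "Y * Y = -1" "Y * X = - (X * Y)" "norm q = 1"
    and "0 \<le> t" "0 \<le> T" "t + T \<le> pi / 2" "cos T \<le> norm (com_part Y q)"
  shows "cos (t + T) \<le> norm (com_part Y (exp (t *\<^sub>R X) * q))"
proof -
  have t: "0 \<le> sin t" "0 \<le> cos t"
    using assms(5-7) by (auto intro!: sin_ge_zero cos_ge_zero)
  have T: "0 \<le> sin T" "0 \<le> cos T"
    using assms(5-7) by (auto intro!: sin_ge_zero cos_ge_zero)
  have "(norm (anticom_part Y q))\<^sup>2 = 1 - (norm (com_part Y q))\<^sup>2"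
    using norm_com_part_anticom_part[OF assms(2), of q] assms(4) by simp
  also have "\<dots> \<le> (sin T)\<^sup>2"
    using power_mono[OF assms(8) T(2), of 2] by (simp add: sin_squared_eq)
  finally have w: "norm (anticom_part Y q) \<le> sin T"
    using T(1) by (rule power2_le_imp_le)
  have "cos (t + T) = cos t * cos T - sin t * sin T"
    by (rule cos_add)
  also have "\<dots> \<le> cos t * norm (com_part Y q) - sin t * norm (anticom_part Y q)"
    using t w assms(8) by (intro diff_mono mult_left_mono)
  \<comment> \<open>The extra minus sign gives the difference of norms the shape of the reverse
    triangle inequality, so that the two terms end up added.\<close>
  also have "\<dots> = norm (cos t *\<^sub>R com_part Y q) - norm (- (sin t *\<^sub>R (X * anticom_part Y q)))"
    using t by (simp add: norm_mult norm_imaginary_unit[OF assms(1)])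
  also have "\<dots> \<le> norm (cos t *\<^sub>R com_part Y q - - (sin t *\<^sub>R (X * anticom_part Y q)))"
    by (rule norm_triangle_ineq2)
  also have "cos t *\<^sub>R com_part Y q - - (sin t *\<^sub>R (X * anticom_part Y q))
      = cos t *\<^sub>R com_part Y q + sin t *\<^sub>R com_part Y (X * q)"
    by (simp add: com_part_mult_anticommuting[OF assms(3)])
  also have "\<dots> = com_part Y (exp (t *\<^sub>R X) * q)"
    by (simp add: exp_scaleR_imaginary_unit[OF assms(1)] com_part_def of_real_def algebra_simps)
  finally show ?thesis .
qed

lemma norm_word_value:
  assumes "X * X = -1" "Y * Y = -1" "admissible X Y w"
  shows "norm (word_value w) = 1"
  using assms(3)
  by (induction w)
    (auto simp: word_value_def admissible_def norm_mult norm_exp_imaginary_unit assms(1,2))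

lemma word_cost_nonneg:
  assumes "admissible X Y w" "0 \<le> \<kappa>"
  shows "0 \<le> word_cost X \<kappa> w"
  using assms by (induction w) (auto simp: word_cost_def admissible_def)

text \<open>The empty word has commuting part 1 and cost 0. Prepending a \<open>Y\<close> factor
  changes neither side, and prepending an \<open>X\<close> factor of time t adds t to the angle
  bound. The bound pi/2 keeps all sines and cosines involved nonnegative.\<close>

lemma cos_word_cost_le:
  assumes "X * X = -1" "Y * Y = -1" "Y * X = - (X * Y)" "X \<noteq> Y"
    and "admissible X Y w" "word_cost X 0 w \<le> pi / 2"
  shows "cos (word_cost X 0 w) \<le> norm (com_part Y (word_value w))"
  using assms(5,6)
proof (induction w)
  case Nil
  have "com_part Y 1 = 1"
    using assms(2) by (simp add: com_part_def flip: scaleR_2)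
  then show ?case
    by (simp add: word_cost_def word_value_def)
next
  case (Cons p w)
  obtain t C where p: "p = (t, C)"
    by (cases p)
  with Cons.prems have adm: "admissible X Y w" and t: "0 \<le> t" and C: "C = X \<or> C = Y"
    by (auto simp: admissible_def)
  have val: "word_value (p # w) = exp (t *\<^sub>R C) * word_value w"
    by (simp add: word_value_def p)
  have cost: "word_cost X 0 (p # w) = (if C = X then t else 0) + word_cost X 0 w"
    by (simp add: word_cost_def p)
  with Cons.prems(2) t have "word_cost X 0 w \<le> pi / 2"
    by (simp split: if_splits)
  then have IH: "cos (word_cost X 0 w) \<le> norm (com_part Y (word_value w))"
    using Cons.IH adm by simp
  show ?case
  proof (cases "C = X")
    case True
    with cost Cons.prems(2) show ?thesis
      using norm_com_part_exp_orthogonal[OF assms(1-3) norm_word_value[OF assms(1,2) adm] t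
          word_cost_nonneg[OF adm order.refl] _ IH]
      by (simp add: val)
  next
    case False
    with C IH show ?thesis
      by (auto simp: val cost norm_com_part_exp_same[OF assms(2)])
  qed
qed

section \<open>Polar form and Euler angles\<close>

lemma commuting_polar:
  fixes Y :: quat
  assumes "Y * Y = -1" "Y * z = z * Y"
  obtains \<phi> where "z = norm z *\<^sub>R exp (\<phi> *\<^sub>R Y)"
proof -
  have emb: "complex_emb Y (Complex (qRe z) (inner z Y)) = z"
  proof -
    have Y: "qRe Y = 0" "(qI Y)\<^sup>2 + (qJ Y)\<^sup>2 + (qK Y)\<^sup>2 = 1"
      using assms(1) unfolding quat_imaginary_unit_iff
      by (auto simp: su2_def norm_quat_def inner_quat_def power2_eq_square)
    \<comment> \<open>Commuting with \<open>Y\<close> means that the cross product of the imaginary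
      parts vanishes, so the imaginary part of \<open>z\<close> is a multiple of
      \<open>Y\<close>.\<close>
    moreover have "qJ Y * qK z = qK Y * qJ z" "qK Y * qI z = qI Y * qK z"
        "qI Y * qJ z = qJ Y * qI z"
      using assms(2) Y(1) by (auto simp: quat_eq_iff algebra_simps)
    ultimately show ?thesis
      unfolding complex_emb_def of_real_def quat_eq_iff inner_quat_def complex.sel
        quat_add_sel quat_scaleR_sel quat_one_sel
      by (intro conjI) algebra+
  qed
  define c where "c = Complex (qRe z) (inner z Y)"
  have "z = complex_emb Y (of_real (cmod c) * cis (Arg c))"
    using emb by (simp add: c_def rcis_cmod_Arg flip: rcis_def)
  then have polar: "z = cmod c *\<^sub>R exp (Arg c *\<^sub>R Y)"
    by (simp add: complex_emb_mult[OF assms(1)] exp_scaleR_imaginary_unit[OF assms(1)])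
      (simp add: complex_emb_def of_real_def)
  then have "norm z = cmod c"
    by (metis norm_exp_imaginary_unit[OF assms(1)] norm_scaleR abs_norm_cancel mult.right_neutral)
  with polar that show ?thesis
    by metis
qed

text \<open>Periodicity turns any real angle into a nonnegative one, as the times in an admissible
  word must be.\<close>

lemma exp_nonneg_angle:
  fixes Y :: quat
  assumes "Y * Y = -1"
  obtains s where "0 \<le> s" "exp (s *\<^sub>R Y) = exp (t *\<^sub>R Y)"
proof -
  obtain s where "0 \<le> s" "cos t = cos s" "sin t = sin s"
    using sincos_total_2pi[of "cos t" "sin t"] by auto
  with that show ?thesis
    by (simp add: exp_scaleR_imaginary_unit[OF assms])
qed

text \<open>Moving the last factor past \<open>X\<close> reverses its angle, so the product is cos b
  exp((a + c) Y) + sin b exp((a - c) Y) X. It remains to match these two terms with the polar forms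
  of the two parts of \<open>g\<close>.\<close>

lemma euler_angles:
  assumes "X * X = -1" "Y * Y = -1" "Y * X = - (X * Y)" "norm g = 1"
  obtains a c where "0 \<le> a" "0 \<le> c"
    "g = exp (a *\<^sub>R Y) * exp (arccos (norm (com_part Y g)) *\<^sub>R X) * exp (c *\<^sub>R Y)"
proof -
  define b where "b = arccos (norm (com_part Y g))"
  have sum: "(norm (com_part Y g))\<^sup>2 + (norm (anticom_part Y g))\<^sup>2 = 1"
    using norm_com_part_anticom_part[OF assms(2), of g] assms(4) by simp
  have le1: "norm (com_part Y g) \<le> 1"
    using norm_com_part_le[OF assms(2), of g] assms(4) by simp
  have cosb: "cos b = norm (com_part Y g)"
    unfolding b_def using le1 by (intro cos_arccos) (auto intro: order_trans[OF _ norm_ge_zero])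
  have sinb: "sin b = norm (anticom_part Y g)"
    unfolding b_def using le1 sum
    by (subst sin_arccos) (auto intro: order_trans[OF _ norm_ge_zero] real_sqrt_unique)
  obtain \<phi> where \<phi>: "com_part Y g = cos b *\<^sub>R exp (\<phi> *\<^sub>R Y)"
    using commuting_polar[OF assms(2) com_part_commute[OF assms(2)]] cosb by metis
  \<comment> \<open>A product of two elements that anticommute with \<open>Y\<close> commutes with
    \<open>Y\<close>, so \<open>v\<close> has a polar form, and \<open>v * X\<close> recovers the
    anticommuting part.\<close>
  define v where "v = - (anticom_part Y g * X)"
  have "Y * v = v * Y"
    unfolding v_def
    by (simp add: anticom_part_anticommute[OF assms(2)] mult.assoc assms(3) flip: mult.assoc[of Y])
  moreover have "norm v = sin b"
    by (simp add: v_def sinb norm_mult norm_imaginary_unit[OF assms(1)])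
  ultimately obtain \<psi> where \<psi>: "v = sin b *\<^sub>R exp (\<psi> *\<^sub>R Y)"
    using commuting_polar[OF assms(2)] by metis
  have w: "anticom_part Y g = v * X"
    by (simp add: v_def mult.assoc assms(1))
  \<comment> \<open>The half sum and half difference solve a + c = \<phi>, a - c = \<psi>, up to
    multiples of 2 pi.\<close>
  obtain a where a: "0 \<le> a" "exp (a *\<^sub>R Y) = exp (((\<phi> + \<psi>) / 2) *\<^sub>R Y)"
    by (rule exp_nonneg_angle[OF assms(2)])
  obtain c where c: "0 \<le> c" "exp (c *\<^sub>R Y) = exp (((\<phi> - \<psi>) / 2) *\<^sub>R Y)"
    by (rule exp_nonneg_angle[OF assms(2)])
  have add: "exp (r *\<^sub>R Y) * exp (s *\<^sub>R Y) = exp ((r + s) *\<^sub>R Y)" for r s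
    by (simp add: exp_add_commuting scaleR_add_left)
  have swap: "X * exp (s *\<^sub>R Y) = exp ((- s) *\<^sub>R Y) * X" for s
    unfolding exp_scaleR_imaginary_unit[OF assms(2)]
    by (simp add: of_real_def algebra_simps assms(3))
  have "exp (a *\<^sub>R Y) * exp (b *\<^sub>R X) * exp (c *\<^sub>R Y)
      = cos b *\<^sub>R (exp (a *\<^sub>R Y) * exp (c *\<^sub>R Y)) + sin b *\<^sub>R (exp (a *\<^sub>R Y) * (X * exp (c *\<^sub>R Y)))"
    by (simp add: exp_scaleR_imaginary_unit[OF assms(1)] of_real_def algebra_simps)
  also have "\<dots> = cos b *\<^sub>R exp (\<phi> *\<^sub>R Y) + sin b *\<^sub>R (exp (\<psi> *\<^sub>R Y) * X)"
    unfolding a(2) c(2) swap mult.assoc[symmetric] add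
    by (simp add: diff_divide_distrib add_divide_distrib)
  also have "\<dots> = g"
    using com_part_add_anticom_part[of Y g] by (simp add: \<phi> w \<psi>)
  finally show ?thesis
    using that[OF a(1) c(1)] by (simp add: b_def)
qed

theorem theorem2p13:
  fixes X Y g :: quat and \<alpha> \<kappa> :: real
  assumes "X \<in> su2" and "norm X = 1"
    and "Y \<in> su2" and "norm Y = 1"
    and "0 < \<alpha>" and "\<alpha> < pi" and "vec_angle X Y = \<alpha>"
    and "0 \<le> \<kappa>" and "\<kappa> \<le> 1"
    and "cos \<alpha> = 0" and "\<kappa> = 0"
    and "g \<in> SU2"
  shows "\<exists>w. admissible X Y w \<and> length w \<le> 3 \<and> word_value w = g
    \<and> word_cost X \<kappa> w = inf_cost X Y \<kappa> g"
proof -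
  have X: "X * X = -1" and Y: "Y * Y = -1"
    using assms(1-4) by (simp_all add: quat_imaginary_unit_iff)
  have "\<bar>inner X Y\<bar> \<le> 1"
    using Cauchy_Schwarz_ineq2[of X Y] assms(2,4) by simp
  then have "inner X Y = cos (vec_angle X Y)"
    by (simp add: vec_angle_def assms(2,4) cos_arccos_abs)
  then have orth: "inner X Y = 0"
    using assms(7,10) by simp
  then have XY: "Y * X = - (X * Y)"
    using assms(1,3) by (intro quat_anticommute)
  have "X \<noteq> Y"
    using orth assms(2) by auto
  have g: "norm g = 1"
    using assms(12) by (simp add: SU2_def)
  define b where "b = arccos (norm (com_part Y g))"
  have le1: "norm (com_part Y g) \<le> 1"
    using norm_com_part_le[OF Y, of g] g by simp
  have b: "0 \<le> b" "b \<le> pi / 2"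
    unfolding b_def using le1 
    by (auto intro!: arccos_lbound arccos_le_pi2 intro: order_trans[OF _ norm_ge_zero]
        simp del: le_divide_eq_numeral1)
  obtain a c where ac: "0 \<le> a" "0 \<le> c" "g = exp (a *\<^sub>R Y) * exp (b *\<^sub>R X) * exp (c *\<^sub>R Y)"
    unfolding b_def by (rule euler_angles[OF X Y XY g])
  \<comment> \<open>Both outer factors are free, so only the middle time \<open>b\<close> is
    paid.\<close>
  define w where "w = [(a, Y), (b, X), (c, Y)]"
  have adm: "admissible X Y w"
    using ac b by (simp add: w_def admissible_def)
  have val: "word_value w = g"
    by (simp add: w_def word_value_def ac(3) mult.assoc)
  have cost: "word_cost X \<kappa> w = b"
    using \<open>X \<noteq> Y\<close> by (simp add: w_def word_cost_def assms(11))
  \<comment> \<open>A word dearer than pi/2 exceeds \<open>b\<close> at once; for the others the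
    cost lies in the range where \<open>arccos\<close> inverts \<open>cos\<close>.\<close>
  have "b \<le> word_cost X \<kappa> u" if u: "admissible X Y u" "word_value u = g" for u
  proof (cases "word_cost X 0 u \<le> pi / 2")
    case True
    have "0 \<le> word_cost X 0 u"
      using u(1) by (intro word_cost_nonneg) auto
    moreover have "cos (word_cost X 0 u) \<le> norm (com_part Y g)"
      using cos_word_cost_le[OF X Y XY \<open>X \<noteq> Y\<close> u(1) True] u(2) by simp
    then have "b \<le> arccos (cos (word_cost X 0 u))"
      unfolding b_def using le1 by (intro arccos_le_arccos) auto
    ultimately show ?thesis
      using True by (simp add: assms(11) arccos_cos)
  next
    case False
    with b(2) show ?thesis
      by (simp add: assms(11))
  qed
  then have "inf_cost X Y \<kappa> g = b"
    unfolding inf_cost_def using adm val cost by (intro cInf_eq_minimum) auto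
  then show ?thesis
    using adm val cost by (intro exI[of _ w]) (simp add: w_def)
qed

end
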